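(* Let $\psi\in\mathscr{P}'(\mathbb{R})$, $f\in\mathscr{P}(\mathbb{R})$, and let $\mu_\alpha=\langle\psi,x^\alpha\rangle$ ($\alpha=0,1,2,\dots$) be the moment sequence of $\psi$. Then for every fixed $b\in\mathbb{R}$, $$\frac{1}{\sqrt a}\Big\langle\psi\Big(\frac{x}{a}\Big),f(x+b)\Big\rangle\sim\sum_{\alpha=0}^{\infty}\frac{\mu_\alpha\, D^\alpha f(b)\,a^{\alpha+1/2}}{\alpha!}\qquad\text{as } a\to 0,\ a>0.$$
   Context: $\mathscr{P}(\mathbb{R})$ is the space of smooth functions $\phi$ on $\mathbb{R}$ such that $\lim_{|x|\to\infty}e^{-\gamma|x|}D^\beta\phi(x)=0$ for every $\gamma>0$ and every $\beta\in\mathbb{N}=\{0,1,2,\dots\}$, topologized by the seminorms $\|\phi\|_{\gamma,\beta}=\sup\{|e^{-\gamma|x|}D^\beta\phi(x)|:x\in\mathbb{R}\}$, $\gamma>0$, $\beta\in\mathbb{N}$. $\mathscr{P}'(\mathbb{R})$ is its dual (distributions of "less than exponential growth"). $D^\alpha$ is the $\alpha$-th derivative. $\langle\cdot,\cdot\rangle$ is the (bilinear) duality pairing in the variable $x$, and for $a>0$ the dilated distribution $\psi(x/a)$ is defined by $\langle\psi(x/a),\phi(x)\rangle=a\langle\psi(x),\phi(ax)\rangle$. The left-hand side is the continuous wavelet transform $(W_\psi f)(a,b)$ of $f$ with respect to $\psi$, formally $\frac{1}{\sqrt a}\int f(x)\,\psi\big(\frac{x-b}{a}\big)\,dx$. The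 relation $\sim$ means asymptotic expansion with respect to the scale $a^{\alpha+1/2}$: for every integer $N\ge 0$, the left-hand side minus the sum of the terms with $\alpha\le N$ is $o(a^{N+1/2})$ as $a\to 0^+$. *)

theory Defs
  imports "HOL-Analysis.Analysis" "HOL-Library.Landau_Symbols"
begin

text \<open>Test functions are complex-valued functions of a real variable.\<close>

definition Dn :: "nat \<Rightarrow> (real \<Rightarrow> complex) \<Rightarrow> real \<Rightarrow> complex" where
  "Dn n \<phi> = ((\<lambda>g x. vector_derivative g (at x)) ^^ n) \<phi>"

definition smooth :: "(real \<Rightarrow> complex) \<Rightarrow> bool" where
  "smooth \<phi> \<longleftrightarrow> (\<forall>n x. Dn n \<phi> differentiable (at x))"

text \<open>On the real line, the filter \<open>at_infinity\<close> is \<open>\<bar>x\<bar> \<rightarrow> \<infinity>\<close>.\<close>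

definition PR :: "(real \<Rightarrow> complex) set" where
  "PR = {\<phi>. smooth \<phi> \<and>
     (\<forall>\<gamma>>0. \<forall>\<beta>. ((\<lambda>x. of_real (exp (- \<gamma> * \<bar>x\<bar>)) * Dn \<beta> \<phi> x) \<longlongrightarrow> 0) at_infinity)}"

text \<open>The supremum is over a bounded set when \<open>\<phi> \<in> PR\<close>; elsewhere the value is irrelevant.\<close>

definition PR_seminorm :: "real \<Rightarrow> nat \<Rightarrow> (real \<Rightarrow> complex) \<Rightarrow> real" where
  "PR_seminorm \<gamma> \<beta> \<phi> = (SUP x. norm (of_real (exp (- \<gamma> * \<bar>x\<bar>)) * Dn \<beta> \<phi> x))"

text \<open>The locally convex topology of the seminorms: the open seminorm balls around all points of
  \<open>PR\<close> form a subbase.\<close>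

definition PR_topology :: "(real \<Rightarrow> complex) topology" where
  "PR_topology = topology_generated_by
     {{\<eta> \<in> PR. PR_seminorm \<gamma> \<beta> (\<lambda>x. \<eta> x - \<phi> x) < \<epsilon>} | \<gamma> \<beta> \<phi> \<epsilon>. \<gamma> > 0 \<and> \<phi> \<in> PR \<and> \<epsilon> > 0}"

text \<open>The pairing \<open>\<langle>\<psi>, \<phi>\<rangle>\<close> is the application \<open>\<psi> \<phi>\<close>. A functional is a total HOL function, so
  linearity and continuity are required on \<open>PR\<close> only; its values off \<open>PR\<close> are arbitrary.\<close>

definition PR_dual :: "((real \<Rightarrow> complex) \<Rightarrow> complex) set" where
  "PR_dual = {\<psi>.
     (\<forall>\<phi>\<in>PR. \<forall>\<eta>\<in>PR. \<psi> (\<lambda>x. \<phi> x + \<eta> x) = \<psi> \<phi> + \<psi> \<eta>) \<and>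
     (\<forall>c. \<forall>\<phi>\<in>PR. \<psi> (\<lambda>x. c * \<phi> x) = c * \<psi> \<phi>) \<and>
     continuous_map PR_topology euclidean \<psi>}"

text \<open>The dilated distribution \<open>\<psi>(x/a)\<close>, for \<open>a > 0\<close>.\<close>

definition dilate :: "real \<Rightarrow> ((real \<Rightarrow> complex) \<Rightarrow> complex) \<Rightarrow> (real \<Rightarrow> complex) \<Rightarrow> complex" where
  "dilate a \<psi> = (\<lambda>\<phi>. of_real a * \<psi> (\<lambda>x. \<phi> (a * x)))"

definition moment :: "((real \<Rightarrow> complex) \<Rightarrow> complex) \<Rightarrow> nat \<Rightarrow> complex" where
  "moment \<psi> \<alpha> = \<psi> (\<lambda>x. of_real (x ^ \<alpha>))"

lemma topspace_PR_topology [simp]: "topspace PR_topology = PR"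
proof -
  have D0: "Dn n (\<lambda>x. 0) = (\<lambda>x. 0)" for n
    by (induction n) (simp_all add: Dn_def)
  let ?B = "\<lambda>\<gamma> \<beta> \<phi> \<epsilon>. {\<eta> \<in> PR. PR_seminorm \<gamma> \<beta> (\<lambda>x. \<eta> x - \<phi> x) < \<epsilon>}"
  let ?S = "{?B \<gamma> \<beta> \<phi> \<epsilon> | \<gamma> \<beta> \<phi> \<epsilon>. \<gamma> > 0 \<and> \<phi> \<in> PR \<and> \<epsilon> > 0}"
  have "\<Union>?S = PR"
  proof
    show "\<Union>?S \<subseteq> PR" by (rule Union_least) force
    show "PR \<subseteq> \<Union>?S"
    proof
      fix \<phi> assume \<phi>: "\<phi> \<in> PR"
      then have "\<phi> \<in> ?B 1 0 \<phi> 1"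
        by (simp add: PR_seminorm_def D0)
      moreover have "?B 1 0 \<phi> 1 \<in> ?S"
        using \<phi> by (intro CollectI exI[of _ "1::real"] exI[of _ "0::nat"] exI[of _ \<phi>]) simp
      ultimately show "\<phi> \<in> \<Union>?S" by (rule UnionI[rotated])
    qed
  qed
  then show ?thesis
    by (simp only: PR_topology_def topology_generated_by_topspace)
qed

end

theory Submission
  imports Defs
begin

text \<open>
  The expansion is Taylor's formula for \<open>f\<close> at \<open>b\<close>, transported by the continuity of \<open>\<psi>\<close>. Let
  \<open>r\<close> be the Taylor remainder of order \<open>N\<close>, as a function of the increment. The dilation
  \<open>x \<mapsto> a x\<close> turns the monomials of the Taylor polynomial into \<open>a ^ \<alpha>\<close> times monomials, on which
  \<open>\<psi>\<close> takes the moments as values. Hence for \<open>a > 0\<close> the left-hand side minus the partial sum is exactly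
  \<open>sqrt a * \<psi> (\<lambda>x. r (a * x))\<close>, and it remains to see that
  \<open>\<psi> (\<lambda>x. r (a * x) / a ^ N) \<longlonglongrightarrow> 0\<close> as \<open>a\<close> decreases to \<open>0\<close>. As \<open>\<psi>\<close> is continuous and linear,
  it is enough that the functions \<open>r (a * x) / a ^ N\<close> tend to \<open>0\<close> in the topology of \<open>PR\<close>.

  That convergence (\<open>flat_dilation_limit\<close>) holds for every \<open>r\<close> in \<open>PR\<close> whose derivatives up to order
  \<open>N\<close> vanish at \<open>0\<close>. By the mean value inequality such a function satisfies
  \<open>\<bar>D\<^sup>\<beta> r(y)\<bar> \<le> C \<bar>y\<bar> ^ (N + 1 - \<beta>) exp (\<delta> \<bar>y\<bar>)\<close> (\<open>flat_bound\<close>). At \<open>y = a x\<close> with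
  \<open>a < 1\<close> the chain rule adds a factor \<open>a ^ \<beta>\<close>, so after division by \<open>a ^ N\<close> one factor
  \<open>a\<close> is left over, while the power of \<open>\<bar>x\<bar>\<close> is absorbed in the exponential weight. Every
  \<open>(\<gamma>, \<beta>)\<close> seminorm is therefore \<open>O(a)\<close>.

  All membership claims in \<open>PR\<close> rest on \<open>PR_iff_exp_bound\<close>, which replaces the limits in the
  definition by bounds.
\<close>

section \<open>Iterated derivatives\<close>

lemma Dn_0: "Dn 0 \<phi> = \<phi>"
  by (simp add: Dn_def)

lemma Dn_Suc: "Dn (Suc n) \<phi> x = vector_derivative (Dn n \<phi>) (at x)"
  by (simp add: Dn_def)

lemma smooth_has_vector_derivative:
  assumes "smooth \<phi>"
  shows "(Dn n \<phi> has_vector_derivative Dn (Suc n) \<phi> x) (at x)"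
  using assms by (simp add: smooth_def Dn_Suc vector_derivative_works)

text \<open>The basic derivative formulas below guess the whole sequence \<open>G\<close> of derivatives; a single
  differentiation step, uniform in \<open>n\<close>, then yields the formula and smoothness together.\<close>

lemma Dn_eqI:
  assumes "\<And>x. \<phi> x = G 0 x"
    and "\<And>n x. (G n has_vector_derivative G (Suc n) x) (at x)"
  shows "Dn n \<phi> = G n"
proof (induction n)
  case 0
  show ?case using assms(1) by (auto simp: Dn_0)
next
  case (Suc n)
  show ?case
    using vector_derivative_at[OF assms(2)] by (auto simp: Dn_Suc Suc.IH)
qed

lemma smoothI:
  assumes "\<And>x. \<phi> x = G 0 x"
    and "\<And>n x. (G n has_vector_derivative G (Suc n) x) (at x)"
  shows "smooth \<phi>"
  unfolding smooth_def
  using Dn_eqI[of \<phi> G, OF assms] assms(2) by (metis differentiableI_vector)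

lemma
  assumes "smooth \<phi>" and "smooth \<eta>"
  shows Dn_add: "Dn n (\<lambda>x. \<phi> x + \<eta> x) = (\<lambda>x. Dn n \<phi> x + Dn n \<eta> x)"
    and smooth_add: "smooth (\<lambda>x. \<phi> x + \<eta> x)"
proof -
  let ?G = "\<lambda>n x. Dn n \<phi> x + Dn n \<eta> x"
  have "(?G n has_vector_derivative ?G (Suc n) x) (at x)" for n x
    by (intro has_vector_derivative_add smooth_has_vector_derivative assms)
  then show "Dn n (\<lambda>x. \<phi> x + \<eta> x) = ?G n" "smooth (\<lambda>x. \<phi> x + \<eta> x)"
    by (intro Dn_eqI[where G = ?G] smoothI[where G = ?G]; simp add: Dn_0)+
qed

lemma
  assumes "smooth \<phi>"
  shows Dn_cmult: "Dn n (\<lambda>x. c * \<phi> x) = (\<lambda>x. c * Dn n \<phi> x)"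
    and smooth_cmult: "smooth (\<lambda>x. c * \<phi> x)"
proof -
  let ?G = "\<lambda>n x. c * Dn n \<phi> x"
  have "(?G n has_vector_derivative ?G (Suc n) x) (at x)" for n x
    by (intro has_vector_derivative_mult_right smooth_has_vector_derivative assms)
  then show "Dn n (\<lambda>x. c * \<phi> x) = ?G n" "smooth (\<lambda>x. c * \<phi> x)"
    by (intro Dn_eqI[where G = ?G] smoothI[where G = ?G]; simp add: Dn_0)+
qed

lemma
  assumes "smooth \<phi>"
  shows Dn_affine: "Dn n (\<lambda>x. \<phi> (a * x + b)) = (\<lambda>x. of_real (a ^ n) * Dn n \<phi> (a * x + b))"
    and smooth_affine: "smooth (\<lambda>x. \<phi> (a * x + b))"
proof -
  let ?G = "\<lambda>n x. of_real (a ^ n) * Dn n \<phi> (a * x + b)"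
  have "(?G n has_vector_derivative ?G (Suc n) x) (at x)" for n x
  proof -
    have "((\<lambda>x. a * x + b) has_vector_derivative a) (at x)"
      by (auto intro!: derivative_eq_intros)
    from vector_diff_chain_at[OF this smooth_has_vector_derivative[OF assms]]
    have "((\<lambda>x. Dn n \<phi> (a * x + b)) has_vector_derivative a *\<^sub>R Dn (Suc n) \<phi> (a * x + b)) (at x)"
      by (simp add: o_def)
    from has_vector_derivative_mult_right[OF this, of "of_real (a ^ n)"]
    show ?thesis by (simp add: scaleR_conv_of_real mult_ac)
  qed
  then show "Dn n (\<lambda>x. \<phi> (a * x + b)) = ?G n" "smooth (\<lambda>x. \<phi> (a * x + b))"
    by (intro Dn_eqI[where G = ?G] smoothI[where G = ?G]; simp add: Dn_0)+
qed

text \<open>Leibniz' rule with a linear factor. At \<open>n = 0\<close> the truncated index \<open>n - 1\<close> is harmless because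
  its coefficient is \<open>0\<close>.\<close>

lemma
  assumes "smooth \<phi>"
  shows Dn_times_x: "Dn n (\<lambda>x. of_real x * \<phi> x) =
      (\<lambda>x. of_real x * Dn n \<phi> x + of_nat n * Dn (n - 1) \<phi> x)"
    and smooth_times_x: "smooth (\<lambda>x. of_real x * \<phi> x)"
proof -
  let ?G = "\<lambda>n x. of_real x * Dn n \<phi> x + of_nat n * Dn (n - 1) \<phi> x"
  have "(?G n has_vector_derivative ?G (Suc n) x) (at x)" for n x
  proof -
    have id: "((\<lambda>x. complex_of_real x) has_vector_derivative 1) (at x)"
      using has_vector_derivative_of_real[OF DERIV_ident, of "at x"] by simp
    have 1: "((\<lambda>x. of_real x * Dn n \<phi> x) has_vector_derivative
        of_real x * Dn (Suc n) \<phi> x + 1 * Dn n \<phi> x) (at x)"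
      by (rule has_vector_derivative_mult[OF id smooth_has_vector_derivative[OF assms]])
    have 2: "((\<lambda>x. of_nat n * Dn (n - 1) \<phi> x) has_vector_derivative of_nat n * Dn n \<phi> x) (at x)"
    proof (cases n)
      case (Suc m)
      then show ?thesis
        using has_vector_derivative_mult_right[OF smooth_has_vector_derivative[OF assms]] by simp
    qed simp
    show ?thesis
      using has_vector_derivative_add[OF 1 2] by (simp add: algebra_simps)
  qed
  then show "Dn n (\<lambda>x. of_real x * \<phi> x) = ?G n" "smooth (\<lambda>x. of_real x * \<phi> x)"
    by (intro Dn_eqI[where G = ?G] smoothI[where G = ?G]; simp add: Dn_0)+
qed

lemma
  shows Dn_const: "Dn n (\<lambda>x. c) = (\<lambda>x. if n = 0 then c else 0)"
    and smooth_const: "smooth (\<lambda>x. c)"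
proof -
  let ?G = "\<lambda>n (x::real). if n = (0::nat) then c else 0"
  have "(?G n has_vector_derivative ?G (Suc n) x) (at x)" for n x
    by simp
  then show "Dn n (\<lambda>x. c) = ?G n" "smooth (\<lambda>x. c)"
    by (intro Dn_eqI[where G = ?G] smoothI[where G = ?G]; simp)+
qed

section \<open>Functions of less than exponential growth\<close>

lemma norm_exp_weight_le_iff:
  fixes z :: complex
  shows
  "norm (of_real (exp (- \<gamma> * \<bar>x\<bar>)) * z) \<le> C \<longleftrightarrow> norm z \<le> C * exp (\<gamma> * \<bar>x\<bar>)"
proof -
  have "norm (of_real (exp (- \<gamma> * \<bar>x\<bar>)) * z) = norm z / exp (\<gamma> * \<bar>x\<bar>)"
    by (simp only: norm_mult norm_of_real abs_exp_cancel) (simp add: exp_minus divide_inverse)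
  then show ?thesis by (simp add: divide_le_eq)
qed

text \<open>A continuous function with limit \<open>0\<close> at infinity is bounded. Conversely, the bound for
  \<open>\<gamma> / 2\<close> leaves a decaying factor \<open>exp (- \<gamma> / 2 * \<bar>x\<bar>)\<close> under the weight for \<open>\<gamma>\<close>.\<close>

lemma PR_iff_exp_bound:
  "\<phi> \<in> PR \<longleftrightarrow> smooth \<phi> \<and> (\<forall>\<gamma>>0. \<forall>\<beta>. \<exists>C. \<forall>x. norm (Dn \<beta> \<phi> x) \<le> C * exp (\<gamma> * \<bar>x\<bar>))"
proof (intro iffI conjI allI impI)
  fix \<gamma> :: real and \<beta> :: nat
  assume \<phi>: "\<phi> \<in> PR" and \<gamma>: "\<gamma> > 0"
  then have sm: "smooth \<phi>" by (simp add: PR_def)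
  let ?h = "\<lambda>x. of_real (exp (- \<gamma> * \<bar>x\<bar>)) * Dn \<beta> \<phi> x"
  have "(?h \<longlongrightarrow> 0) at_infinity"
    using \<phi> \<gamma> by (simp add: PR_def)
  then have "\<forall>\<^sub>F x in at_infinity. norm (?h x) < 1"
    by (auto simp: tendsto_iff)
  then obtain R where R: "\<And>x. norm x \<ge> R \<Longrightarrow> norm (?h x) < 1"
    by (auto simp: eventually_at_infinity)
  have "continuous_on UNIV (Dn \<beta> \<phi>)"
    using smooth_has_vector_derivative[OF sm]
    by (intro continuous_at_imp_continuous_on) (blast intro: has_vector_derivative_continuous)
  then have "continuous_on {-R..R} ?h"
    by (intro continuous_intros) (auto intro: continuous_on_subset)
  then have "bounded (?h ` {-R..R})"
    using compact_continuous_image compact_imp_bounded by blast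
  then obtain B where B: "\<And>x. x \<in> {-R..R} \<Longrightarrow> norm (?h x) \<le> B"
    unfolding bounded_iff by blast
  have "norm (Dn \<beta> \<phi> x) \<le> max 1 B * exp (\<gamma> * \<bar>x\<bar>)" for x
  proof -
    have "norm (?h x) \<le> max 1 B"
      using R[of x] B[of x] by (cases "norm x \<ge> R") (force simp: abs_le_iff)+
    then show ?thesis by (simp only: norm_exp_weight_le_iff)
  qed
  then show "\<exists>C. \<forall>x. norm (Dn \<beta> \<phi> x) \<le> C * exp (\<gamma> * \<bar>x\<bar>)" by blast
next
  assume "\<phi> \<in> PR"
  then show "smooth \<phi>" by (simp add: PR_def)
next
  assume R: "smooth \<phi> \<and> (\<forall>\<gamma>>0. \<forall>\<beta>. \<exists>C. \<forall>x. norm (Dn \<beta> \<phi> x) \<le> C * exp (\<gamma> * \<bar>x\<bar>))"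
  have "((\<lambda>x. of_real (exp (- \<gamma> * \<bar>x\<bar>)) * Dn \<beta> \<phi> x) \<longlongrightarrow> 0) at_infinity"
    if pos: "\<gamma> > 0" for \<gamma> \<beta>
  proof -
    obtain C where C: "\<forall>x. norm (Dn \<beta> \<phi> x) \<le> C * exp (\<gamma> / 2 * \<bar>x\<bar>)"
      using R[THEN conjunct2, rule_format, OF half_gt_zero[OF pos], of \<beta>] ..
    have "((\<lambda>x::real. C * exp (- (\<gamma> / 2 * norm x))) \<longlongrightarrow> C * 0) at_infinity"
      using pos
      by (intro tendsto_intros filterlim_compose[OF exp_at_bot]
          filterlim_compose[OF filterlim_uminus_at_bot_at_top]
          filterlim_tendsto_pos_mult_at_top[OF tendsto_const] filterlim_norm_at_top) auto
    then have lim: "((\<lambda>x::real. C * exp (- (\<gamma> / 2 * norm x))) \<longlongrightarrow> 0) at_infinity"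
      by (simp only: mult_zero_right)
    have bound: "norm (of_real (exp (- \<gamma> * \<bar>x\<bar>)) * Dn \<beta> \<phi> x) \<le> C * exp (- (\<gamma> / 2 * norm x))" for x
    proof -
      have "exp (\<gamma> / 2 * \<bar>x\<bar>) = exp (- (\<gamma> / 2 * norm x)) * exp (\<gamma> * \<bar>x\<bar>)"
        unfolding exp_add[symmetric] by simp
      with C[rule_format, of x] show ?thesis
        by (simp only: norm_exp_weight_le_iff mult.assoc)
    qed
    show ?thesis
      by (rule Lim_null_comparison[OF always_eventually[OF allI[OF bound]] lim])
  qed
  with R show "\<phi> \<in> PR" by (simp add: PR_def)
qed

lemma PR_smooth: "\<phi> \<in> PR \<Longrightarrow> smooth \<phi>"
  by (simp add: PR_def)

lemma PR_exp_bound: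
  assumes "\<phi> \<in> PR" and "\<gamma> > 0"
  obtains C where "C \<ge> 0" and "\<And>x. norm (Dn \<beta> \<phi> x) \<le> C * exp (\<gamma> * \<bar>x\<bar>)"
proof -
  obtain C where C: "\<And>x. norm (Dn \<beta> \<phi> x) \<le> C * exp (\<gamma> * \<bar>x\<bar>)"
    using assms by (meson PR_iff_exp_bound)
  moreover have "C \<ge> 0"
    using order_trans[OF norm_ge_zero C[of 0]] by simp
  ultimately show ?thesis using that by blast
qed

lemma PR_add:
  assumes "\<phi> \<in> PR" and "\<eta> \<in> PR"
  shows "(\<lambda>x. \<phi> x + \<eta> x) \<in> PR"
  unfolding PR_iff_exp_bound
proof (intro conjI allI impI)
  fix \<gamma> :: real and \<beta> :: nat assume \<gamma>: "\<gamma> > 0"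
  obtain A where A: "A \<ge> 0" "\<And>x. norm (Dn \<beta> \<phi> x) \<le> A * exp (\<gamma> * \<bar>x\<bar>)"
    by (rule PR_exp_bound[OF assms(1) \<gamma>, where \<beta> = "\<beta>"]) (rule that)
  obtain B where B: "B \<ge> 0" "\<And>x. norm (Dn \<beta> \<eta> x) \<le> B * exp (\<gamma> * \<bar>x\<bar>)"
    by (rule PR_exp_bound[OF assms(2) \<gamma>, where \<beta> = "\<beta>"]) (rule that)
  have "norm (Dn \<beta> \<phi> x + Dn \<beta> \<eta> x) \<le> (A + B) * exp (\<gamma> * \<bar>x\<bar>)" for x
    using norm_triangle_ineq[of "Dn \<beta> \<phi> x" "Dn \<beta> \<eta> x"] A(2)[of x] B(2)[of x]
    by (simp add: algebra_simps)
  then show "\<exists>C. \<forall>x. norm (Dn \<beta> (\<lambda>x. \<phi> x + \<eta> x) x) \<le> C * exp (\<gamma> * \<bar>x\<bar>)"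
    unfolding Dn_add[OF assms[THEN PR_smooth]] by blast
qed (intro smooth_add PR_smooth assms)

lemma PR_cmult:
  assumes "\<phi> \<in> PR"
  shows "(\<lambda>x. c * \<phi> x) \<in> PR"
  unfolding PR_iff_exp_bound
proof (intro conjI allI impI)
  fix \<gamma> :: real and \<beta> :: nat assume \<gamma>: "\<gamma> > 0"
  obtain A where A: "A \<ge> 0" "\<And>x. norm (Dn \<beta> \<phi> x) \<le> A * exp (\<gamma> * \<bar>x\<bar>)"
    by (rule PR_exp_bound[OF assms(1) \<gamma>, where \<beta> = "\<beta>"]) (rule that)
  have "norm (c * Dn \<beta> \<phi> x) \<le> (norm c * A) * exp (\<gamma> * \<bar>x\<bar>)" for x
    using mult_left_mono[OF A(2)[of x], of "norm c"] by (simp add: norm_mult mult.assoc)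
  then show "\<exists>C. \<forall>x. norm (Dn \<beta> (\<lambda>x. c * \<phi> x) x) \<le> C * exp (\<gamma> * \<bar>x\<bar>)"
    unfolding Dn_cmult[OF assms[THEN PR_smooth]] by blast
qed (intro smooth_cmult PR_smooth assms)

lemma PR_const: "(\<lambda>x. c) \<in> PR"
  unfolding PR_iff_exp_bound
proof (intro conjI allI impI)
  fix \<gamma> :: real and \<beta> :: nat assume \<gamma>: "\<gamma> > 0"
  have "norm c \<le> norm c * exp (\<gamma> * \<bar>x\<bar>)" for x
    using mult_left_mono[of 1 "exp (\<gamma> * \<bar>x\<bar>)" "norm c"] \<gamma> by simp
  then show "\<exists>C. \<forall>x. norm (Dn \<beta> (\<lambda>x. c) x) \<le> C * exp (\<gamma> * \<bar>x\<bar>)"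
    by (intro exI[of _ "norm c"]) (auto simp: Dn_const)
qed (rule smooth_const)

lemma PR_diff:
  assumes "\<phi> \<in> PR" and "\<eta> \<in> PR"
  shows "(\<lambda>x. \<phi> x - \<eta> x) \<in> PR"
  using PR_add[OF assms(1) PR_cmult[OF assms(2), of "-1"]] by simp

lemma PR_sum:
  assumes "\<And>i. i \<in> I \<Longrightarrow> \<phi> i \<in> PR"
  shows "(\<lambda>x. \<Sum>i\<in>I. \<phi> i x) \<in> PR"
  using assms by (induction I rule: infinite_finite_induct) (auto intro: PR_add PR_const)

lemma PR_affine:
  assumes "\<phi> \<in> PR"
  shows "(\<lambda>x. \<phi> (a * x + b)) \<in> PR"
  unfolding PR_iff_exp_bound
proof (intro conjI allI impI)
  fix \<gamma> :: real and \<beta> :: nat assume \<gamma>: "\<gamma> > 0"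
  \<comment> \<open>The dilation multiplies the growth rate by \<open>\<bar>a\<bar>\<close>; the summand \<open>1\<close> covers \<open>a = 0\<close>.\<close>
  define \<delta> where "\<delta> = \<gamma> / (1 + \<bar>a\<bar>)"
  have \<delta>: "\<delta> > 0" "\<delta> * \<bar>a\<bar> \<le> \<gamma>"
    using \<gamma> mult_left_mono[of "\<bar>a\<bar>" "1 + \<bar>a\<bar>" \<gamma>] by (auto simp: \<delta>_def divide_le_eq)
  obtain A where A: "A \<ge> 0" "\<And>x. norm (Dn \<beta> \<phi> x) \<le> A * exp (\<delta> * \<bar>x\<bar>)"
    by (rule PR_exp_bound[OF assms(1) \<delta>(1), where \<beta> = "\<beta>"]) (rule that)
  have "norm (of_real (a ^ \<beta>) * Dn \<beta> \<phi> (a * x + b)) \<le> (\<bar>a\<bar> ^ \<beta> * A * exp (\<delta> * \<bar>b\<bar>)) * exp (\<gamma> * \<bar>x\<bar>)" for x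
  proof -
    have "\<delta> * \<bar>a * x + b\<bar> \<le> \<delta> * (\<bar>a\<bar> * \<bar>x\<bar> + \<bar>b\<bar>)"
      using \<delta> by (intro mult_left_mono) (auto simp: abs_mult[symmetric])
    also have "\<dots> \<le> \<delta> * \<bar>b\<bar> + \<gamma> * \<bar>x\<bar>"
      using mult_right_mono[OF \<delta>(2), of "\<bar>x\<bar>"] by (simp add: algebra_simps)
    finally have "exp (\<delta> * \<bar>a * x + b\<bar>) \<le> exp (\<delta> * \<bar>b\<bar>) * exp (\<gamma> * \<bar>x\<bar>)"
      by (simp add: exp_add[symmetric])
    from mult_left_mono[OF this A(1)] A(2)[of "a * x + b"]
    have "norm (Dn \<beta> \<phi> (a * x + b)) \<le> A * (exp (\<delta> * \<bar>b\<bar>) * exp (\<gamma> * \<bar>x\<bar>))"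
      by linarith
    from mult_left_mono[OF this, of "\<bar>a\<bar> ^ \<beta>"]
    show ?thesis by (simp add: norm_mult norm_power power_abs mult.assoc)
  qed
  then show "\<exists>C. \<forall>x. norm (Dn \<beta> (\<lambda>x. \<phi> (a * x + b)) x) \<le> C * exp (\<gamma> * \<bar>x\<bar>)"
    unfolding Dn_affine[OF PR_smooth[OF assms]] by blast
qed (intro smooth_affine PR_smooth assms)

text \<open>Half of the growth rate is left for \<open>\<phi>\<close>, the other half absorbs the factor \<open>x\<close>.\<close>

lemma PR_times_x:
  assumes "\<phi> \<in> PR"
  shows "(\<lambda>x. of_real x * \<phi> x) \<in> PR"
  unfolding PR_iff_exp_bound
proof (intro conjI allI impI)
  fix \<gamma> :: real and \<beta> :: nat assume \<gamma>: "\<gamma> > 0"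
  define \<delta> where "\<delta> = \<gamma> / 2"
  have \<delta>: "\<delta> > 0" "\<gamma> = \<delta> + \<delta>" using \<gamma> by (auto simp: \<delta>_def)
  obtain A where A: "A \<ge> 0" "\<And>x. norm (Dn \<beta> \<phi> x) \<le> A * exp (\<delta> * \<bar>x\<bar>)"
    by (rule PR_exp_bound[OF assms(1) \<delta>(1), where \<beta> = "\<beta>"]) (rule that)
  obtain B where B: "B \<ge> 0" "\<And>x. norm (Dn (\<beta> - 1) \<phi> x) \<le> B * exp (\<gamma> * \<bar>x\<bar>)"
    by (rule PR_exp_bound[OF assms(1) \<gamma>, where \<beta> = "\<beta> - 1"]) (rule that)
  have "norm (of_real x * Dn \<beta> \<phi> x + of_nat \<beta> * Dn (\<beta> - 1) \<phi> x)
      \<le> (A / \<delta> + real \<beta> * B) * exp (\<gamma> * \<bar>x\<bar>)" for x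
  proof -
    have "\<delta> * \<bar>x\<bar> \<le> exp (\<delta> * \<bar>x\<bar>)"
      using exp_ge_add_one_self[of "\<delta> * \<bar>x\<bar>"] by linarith
    then have "\<bar>x\<bar> \<le> exp (\<delta> * \<bar>x\<bar>) / \<delta>"
      using \<delta> by (simp add: field_simps)
    then have "\<bar>x\<bar> * norm (Dn \<beta> \<phi> x) \<le> exp (\<delta> * \<bar>x\<bar>) / \<delta> * (A * exp (\<delta> * \<bar>x\<bar>))"
      using A \<delta> by (intro mult_mono) auto
    also have "\<dots> = A / \<delta> * exp (\<gamma> * \<bar>x\<bar>)"
      unfolding \<delta>(2) distrib_right exp_add by simp
    finally have 1: "norm (of_real x * Dn \<beta> \<phi> x) \<le> A / \<delta> * exp (\<gamma> * \<bar>x\<bar>)"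
      by (simp add: norm_mult)
    have 2: "norm (of_nat \<beta> * Dn (\<beta> - 1) \<phi> x) \<le> real \<beta> * B * exp (\<gamma> * \<bar>x\<bar>)"
      using mult_left_mono[OF B(2)[of x], of "real \<beta>"] by (simp add: norm_mult mult.assoc)
    show ?thesis
      using norm_triangle_le[OF add_mono[OF 1 2]] by (simp add: algebra_simps)
  qed
  then show "\<exists>C. \<forall>x. norm (Dn \<beta> (\<lambda>x. of_real x * \<phi> x) x) \<le> C * exp (\<gamma> * \<bar>x\<bar>)"
    unfolding Dn_times_x[OF PR_smooth[OF assms]] by blast
qed (intro smooth_times_x PR_smooth assms)

lemma PR_monomial: "(\<lambda>x. of_real (x ^ k)) \<in> PR"
proof (induction k)
  case (Suc k)
  then show ?case using PR_times_x[OF Suc.IH] by simp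
qed (simp add: PR_const)

text \<open>This is how the Taylor polynomial cancels the derivatives of \<open>f\<close> at the base point: the
  \<open>\<alpha>\<close>-th term contributes to the derivative of order \<open>\<alpha>\<close> alone.\<close>

lemma Dn_monomial_0: "Dn n (\<lambda>x. of_real (x ^ k)) 0 = (if n = k then fact k else 0)"
proof (induction k arbitrary: n)
  case 0
  show ?case by (simp add: Dn_const)
next
  case (Suc k)
  have "Dn n (\<lambda>x. of_real (x ^ Suc k)) 0 = of_nat n * Dn (n - 1) (\<lambda>x. of_real (x ^ k)) 0"
    using Dn_times_x[OF PR_smooth[OF PR_monomial[of k]], of n] by simp
  also have "\<dots> = (if n = Suc k then fact (Suc k) else 0)"
    by (cases n) (simp_all add: Suc.IH del: of_real_power)
  finally show ?case .
qed

lemma Dn_sum: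
  assumes "\<And>i. i \<in> I \<Longrightarrow> \<phi> i \<in> PR"
  shows "Dn n (\<lambda>x. \<Sum>i\<in>I. \<phi> i x) = (\<lambda>x. \<Sum>i\<in>I. Dn n (\<phi> i) x)"
  using assms
proof (induction I rule: infinite_finite_induct)
  case (insert i I)
  then show ?case by (simp add: Dn_add PR_smooth PR_sum)
qed (auto simp: Dn_const)

lemma Dn_diff:
  assumes "smooth \<phi>" and "smooth \<eta>"
  shows "Dn n (\<lambda>x. \<phi> x - \<eta> x) = (\<lambda>x. Dn n \<phi> x - Dn n \<eta> x)"
  using Dn_add[OF assms(1) smooth_cmult[OF assms(2), of "-1"], of n]
    Dn_cmult[OF assms(2), of n "-1"] by simp

section \<open>Seminorms and convergence\<close>

lemma PR_seminorm_le:
  assumes "\<And>x. norm (Dn \<beta> \<phi> x) \<le> B * exp (\<gamma> * \<bar>x\<bar>)"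
  shows "PR_seminorm \<gamma> \<beta> \<phi> \<le> B"
  unfolding PR_seminorm_def
  using assms by (intro cSUP_least) (simp_all only: norm_exp_weight_le_iff UNIV_not_empty not_False_eq_True)

lemma Dn_le_PR_seminorm:
  assumes "\<phi> \<in> PR" and "\<gamma> > 0"
  shows "norm (Dn \<beta> \<phi> x) \<le> PR_seminorm \<gamma> \<beta> \<phi> * exp (\<gamma> * \<bar>x\<bar>)"
proof -
  obtain C where C: "C \<ge> 0" "\<And>x. norm (Dn \<beta> \<phi> x) \<le> C * exp (\<gamma> * \<bar>x\<bar>)"
    by (rule PR_exp_bound[OF assms, where \<beta> = "\<beta>"]) (rule that)
  from C(2) have "bdd_above (range (\<lambda>x. norm (of_real (exp (- \<gamma> * \<bar>x\<bar>)) * Dn \<beta> \<phi> x)))"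
    by (intro bdd_aboveI2[of _ _ C]) (simp only: norm_exp_weight_le_iff)
  then have "norm (of_real (exp (- \<gamma> * \<bar>x\<bar>)) * Dn \<beta> \<phi> x) \<le> PR_seminorm \<gamma> \<beta> \<phi>"
    unfolding PR_seminorm_def by (intro cSUP_upper) auto
  then show ?thesis by (simp only: norm_exp_weight_le_iff)
qed

lemma PR_seminorm_triangle:
  assumes "\<phi> \<in> PR" and "\<eta> \<in> PR" and "\<gamma> > 0"
  shows "PR_seminorm \<gamma> \<beta> (\<lambda>x. \<phi> x + \<eta> x) \<le> PR_seminorm \<gamma> \<beta> \<phi> + PR_seminorm \<gamma> \<beta> \<eta>"
proof (rule PR_seminorm_le)
  fix x
  show "norm (Dn \<beta> (\<lambda>x. \<phi> x + \<eta> x) x)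
      \<le> (PR_seminorm \<gamma> \<beta> \<phi> + PR_seminorm \<gamma> \<beta> \<eta>) * exp (\<gamma> * \<bar>x\<bar>)"
    using norm_triangle_le[OF add_mono[OF Dn_le_PR_seminorm[OF assms(1,3), of \<beta> x]
          Dn_le_PR_seminorm[OF assms(2,3), of \<beta> x]]]
    by (simp add: Dn_add PR_smooth assms algebra_simps)
qed

text \<open>The subbasic balls have arbitrary centres \<open>\<zeta>\<close>, so the triangle inequality is needed to pass from
  seminorm convergence to \<open>\<phi>\<close> to membership in a ball that merely contains \<open>\<phi>\<close>. Finite
  intersections and unions are handled by induction over the generated topology.\<close>

lemma limitin_PR_topologyI:
  assumes "\<phi> \<in> PR" and "\<forall>\<^sub>F i in F. g i \<in> PR"
    and lim: "\<And>\<gamma> \<beta>. \<gamma> > 0 \<Longrightarrow>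
      ((\<lambda>i. PR_seminorm \<gamma> \<beta> (\<lambda>x. g i x - \<phi> x)) \<longlongrightarrow> 0) F"
  shows "limitin PR_topology g \<phi> F"
proof -
  let ?S = "{{\<eta> \<in> PR. PR_seminorm \<gamma> \<beta> (\<lambda>x. \<eta> x - \<zeta> x) < \<epsilon>} | \<gamma> \<beta> \<zeta> \<epsilon>. \<gamma> > 0 \<and> \<zeta> \<in> PR \<and> \<epsilon> > 0}"
  have "\<phi> \<in> U \<longrightarrow> (\<forall>\<^sub>F i in F. g i \<in> U)"
    if "generate_topology_on ?S U" for U
    using that
  proof induction
    case (Int U V)
    then show ?case by (auto elim: eventually_elim2)
  next
    case (UN K)
    show ?case
    proof
      assume "\<phi> \<in> \<Union>K"
      then obtain k where "k \<in> K" "\<phi> \<in> k" by blast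
      then have "\<forall>\<^sub>F i in F. g i \<in> k" using UN by blast
      then show "\<forall>\<^sub>F i in F. g i \<in> \<Union>K"
        by eventually_elim (use \<open>k \<in> K\<close> in blast)
    qed
  next
    case (Basis U)
    then obtain \<gamma> \<beta> \<zeta> \<epsilon> where U: "U = {\<eta> \<in> PR. PR_seminorm \<gamma> \<beta> (\<lambda>x. \<eta> x - \<zeta> x) < \<epsilon>}"
      and "\<gamma> > 0" "\<zeta> \<in> PR" by blast
    show ?case
    proof
      assume "\<phi> \<in> U"
      then have "0 < \<epsilon> - PR_seminorm \<gamma> \<beta> (\<lambda>x. \<phi> x - \<zeta> x)" by (simp add: U)
      from order_tendstoD(2)[OF lim[OF \<open>\<gamma> > 0\<close>, of \<beta>] this] assms(2)
      show "\<forall>\<^sub>F i in F. g i \<in> U"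
      proof eventually_elim
        case (elim i)
        have "PR_seminorm \<gamma> \<beta> (\<lambda>x. g i x - \<zeta> x)
            \<le> PR_seminorm \<gamma> \<beta> (\<lambda>x. g i x - \<phi> x) + PR_seminorm \<gamma> \<beta> (\<lambda>x. \<phi> x - \<zeta> x)"
          using PR_seminorm_triangle[OF PR_diff[OF elim(2) assms(1)]
              PR_diff[OF assms(1) \<open>\<zeta> \<in> PR\<close>] \<open>\<gamma> > 0\<close>, of \<beta>] by simp
        with elim show ?case by (simp add: U)
      qed
    qed
  qed simp
  then show ?thesis
    using assms(1) unfolding limitin_def topspace_PR_topology
    by (simp add: PR_topology_def openin_topology_generated_by_iff)
qed

section \<open>Dilating a function that is flat at the origin\<close>

text \<open>Downward induction on \<open>\<beta>\<close>, starting at \<open>\<beta> > N\<close>, where the truncated exponent is \<open>0\<close> and the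
  growth bound of \<open>PR\<close> suffices. Since \<open>D\<^sup>\<beta> r\<close> vanishes at \<open>0\<close> for \<open>\<beta> \<le> N\<close>, the mean value
  inequality on the segment from \<open>0\<close> to \<open>y\<close> turns the bound for order \<open>\<beta> + 1\<close> into one for order
  \<open>\<beta>\<close> with one more factor \<open>\<bar>y\<bar>\<close>.\<close>

lemma flat_bound:
  assumes r: "r \<in> PR" and flat: "\<And>k. k \<le> N \<Longrightarrow> Dn k r 0 = 0" and \<gamma>: "\<gamma> > 0"
  shows "\<exists>C\<ge>0. \<forall>y. norm (Dn \<beta> r y) \<le> C * \<bar>y\<bar> ^ (N + 1 - \<beta>) * exp (\<gamma> * \<bar>y\<bar>)"
proof (induction "N + 1 - \<beta>" arbitrary: \<beta>)
  case 0
  then show ?case using PR_exp_bound[OF r \<gamma>, of \<beta>] by (metis mult.right_neutral power_0)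
next
  case (Suc m)
  then have \<beta>: "\<beta> \<le> N" and "m = N + 1 - Suc \<beta>" by linarith+
  with Suc.hyps(1)[of "Suc \<beta>"] obtain C where "C \<ge> 0"
    and C: "\<And>y. norm (Dn (Suc \<beta>) r y) \<le> C * \<bar>y\<bar> ^ m * exp (\<gamma> * \<bar>y\<bar>)" by metis
  have "norm (Dn \<beta> r y) \<le> C * \<bar>y\<bar> ^ Suc m * exp (\<gamma> * \<bar>y\<bar>)" for y
  proof -
    let ?S = "closed_segment 0 y"
    have "norm (Dn \<beta> r y - Dn \<beta> r 0) \<le> (C * \<bar>y\<bar> ^ m * exp (\<gamma> * \<bar>y\<bar>)) * norm (y - 0)"
    proof (rule differentiable_bound[where f' = "\<lambda>t h. h *\<^sub>R Dn (Suc \<beta>) r t"])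
      fix t assume "t \<in> ?S"
      then have "\<bar>t\<bar> \<le> \<bar>y\<bar>" by (auto simp: closed_segment_eq_real_ivl split: if_splits)
      then have "C * \<bar>t\<bar> ^ m * exp (\<gamma> * \<bar>t\<bar>) \<le> C * \<bar>y\<bar> ^ m * exp (\<gamma> * \<bar>y\<bar>)"
        using \<open>C \<ge> 0\<close> \<gamma> by (intro mult_mono power_mono) auto
      with C[of t] have "norm (Dn (Suc \<beta>) r t) \<le> C * \<bar>y\<bar> ^ m * exp (\<gamma> * \<bar>y\<bar>)"
        by linarith
      from mult_left_mono[OF this]
      show "onorm (\<lambda>h. h *\<^sub>R Dn (Suc \<beta>) r t) \<le> C * \<bar>y\<bar> ^ m * exp (\<gamma> * \<bar>y\<bar>)"
        by (intro onorm_le) (simp add: mult.commute)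
      show "(Dn \<beta> r has_derivative (\<lambda>h. h *\<^sub>R Dn (Suc \<beta>) r t)) (at t within ?S)"
        using smooth_has_vector_derivative[OF PR_smooth[OF r]]
        by (simp add: has_vector_derivative_def has_derivative_at_withinI)
    qed auto
    then show ?thesis by (simp add: flat[OF \<beta>] mult_ac)
  qed
  then show ?case using \<open>C \<ge> 0\<close> Suc.hyps(2) by metis
qed

text \<open>The \<open>\<beta>\<close>-th derivative of \<open>r (a * x) / a ^ N\<close> carries the powers
  \<open>a ^ \<beta> / a ^ N * a ^ (N + 1 - \<beta>)\<close>, which is at most \<open>a\<close> for \<open>0 < a < 1\<close>: with equality for
  \<open>\<beta> \<le> N + 1\<close>, and because of truncated subtraction with room to spare beyond.\<close>

lemma flat_dilation_limit:
  assumes r: "r \<in> PR" and flat: "\<And>k. k \<le> N \<Longrightarrow> Dn k r 0 = 0"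
  shows "limitin PR_topology (\<lambda>a x. of_real (1 / a ^ N) * r (a * x)) (\<lambda>x. 0) (at_right 0)"
proof (rule limitin_PR_topologyI)
  have ra: "(\<lambda>x. r (a * x)) \<in> PR" for a
    using PR_affine[OF r, of a 0] by simp
  show "\<forall>\<^sub>F a in at_right 0. (\<lambda>x. of_real (1 / a ^ N) * r (a * x)) \<in> PR"
    by (intro always_eventually allI PR_cmult ra)
  fix \<gamma> :: real and \<beta> :: nat assume \<gamma>: "\<gamma> > 0"
  \<comment> \<open>One \<open>\<delta>\<close> pays for the growth of \<open>r\<close>, the other for the power \<open>\<bar>x\<bar> ^ m\<close>.\<close>
  define m where "m = N + 1 - \<beta>"
  define \<delta> where "\<delta> = \<gamma> / 2"
  have \<delta>: "\<delta> > 0" "\<gamma> = \<delta> + \<delta>" using \<gamma> by (auto simp: \<delta>_def)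
  obtain C where C: "C \<ge> 0" "\<And>y. norm (Dn \<beta> r y) \<le> C * \<bar>y\<bar> ^ m * exp (\<delta> * \<bar>y\<bar>)"
    using flat_bound[OF r flat \<delta>(1), of N \<beta>] by (auto simp: m_def)
  obtain K where K: "K \<ge> 0" "\<And>x. \<bar>x\<bar> ^ m \<le> K * exp (\<delta> * \<bar>x\<bar>)"
    \<comment> \<open>The growth of a power is the case \<open>\<beta> = 0\<close> of the monomial's membership in \<open>PR\<close>.\<close>
    using PR_exp_bound[OF PR_monomial[of m] \<delta>(1), of 0] by (auto simp: Dn_0 norm_power power_abs)
  let ?p = "\<lambda>a. PR_seminorm \<gamma> \<beta> (\<lambda>x. of_real (1 / a ^ N) * r (a * x) - 0)"
  have upper: "?p a \<le> C * K * a" if a: "0 < a" "a < 1" for a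
  proof (rule PR_seminorm_le)
    fix x
    have D: "Dn \<beta> (\<lambda>x. of_real (1 / a ^ N) * r (a * x) - 0) x
        = of_real (a ^ \<beta> / a ^ N) * Dn \<beta> r (a * x)"
      using Dn_cmult[OF PR_smooth[OF ra], of \<beta> "of_real (1 / a ^ N)" a]
        Dn_affine[OF PR_smooth[OF r], of \<beta> a 0] by simp
    have "a ^ (\<beta> + m) \<le> a ^ (N + 1)"
      using a by (intro power_decreasing) (auto simp: m_def)
    then have am: "a ^ \<beta> / a ^ N * a ^ m \<le> a"
      using a by (simp add: field_simps power_add)
    have "\<bar>a * x\<bar> \<le> \<bar>x\<bar>"
      using a by (simp add: abs_mult mult_left_le_one_le)
    then have "C * \<bar>a * x\<bar> ^ m * exp (\<delta> * \<bar>a * x\<bar>) \<le> C * \<bar>a * x\<bar> ^ m * exp (\<delta> * \<bar>x\<bar>)"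
      using \<delta> C(1) by (intro mult_left_mono) auto
    with C(2)[of "a * x"] have "norm (Dn \<beta> r (a * x)) \<le> C * \<bar>a * x\<bar> ^ m * exp (\<delta> * \<bar>x\<bar>)"
      by linarith
    from mult_left_mono[OF this, of "a ^ \<beta> / a ^ N"]
    have "norm (Dn \<beta> (\<lambda>x. of_real (1 / a ^ N) * r (a * x) - 0) x)
        \<le> a ^ \<beta> / a ^ N * (C * \<bar>a * x\<bar> ^ m * exp (\<delta> * \<bar>x\<bar>))"
      using a by (simp only: D norm_mult norm_of_real) simp
    also have "\<dots> = (a ^ \<beta> / a ^ N * a ^ m) * (C * \<bar>x\<bar> ^ m * exp (\<delta> * \<bar>x\<bar>))"
      using a by (simp add: abs_mult power_mult_distrib)
    also have "\<dots> \<le> a * (C * (K * exp (\<delta> * \<bar>x\<bar>)) * exp (\<delta> * \<bar>x\<bar>))"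
      using a am C K by (intro mult_mono) auto
    also have "\<dots> = C * K * a * exp (\<gamma> * \<bar>x\<bar>)"
      unfolding \<delta>(2) distrib_right exp_add by simp
    finally show "norm (Dn \<beta> (\<lambda>x. of_real (1 / a ^ N) * r (a * x) - 0) x)
        \<le> C * K * a * exp (\<gamma> * \<bar>x\<bar>)" .
  qed
  have lower: "0 \<le> ?p a" for a
  proof -
    have "(\<lambda>x. of_real (1 / a ^ N) * r (a * x) - 0) \<in> PR"
      unfolding diff_zero by (rule PR_cmult[OF ra])
    from order_trans[OF norm_ge_zero Dn_le_PR_seminorm[OF this \<gamma>, of \<beta> 0]]
    show ?thesis by simp
  qed
  have lim: "((\<lambda>a. C * K * a) \<longlongrightarrow> 0) (at_right 0)"
    by (intro tendsto_mult_right_zero tendsto_ident_at)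
  have "\<forall>\<^sub>F a in at_right 0. a \<in> {0<..<1::real}"
    by (rule eventually_at_right_real) simp
  then have "\<forall>\<^sub>F a in at_right 0. ?p a \<le> C * K * a"
  proof eventually_elim
    case (elim a)
    show ?case by (rule upper) (use elim in simp_all)
  qed
  then show "(?p \<longlongrightarrow> 0) (at_right 0)"
    by (rule tendsto_sandwich[OF always_eventually[OF allI[OF lower]] _ tendsto_const lim])
qed (rule PR_const)

section \<open>The asymptotic expansion\<close>

lemma PR_dual_add:
  assumes "\<psi> \<in> PR_dual" "\<phi> \<in> PR" "\<eta> \<in> PR"
  shows "\<psi> (\<lambda>x. \<phi> x + \<eta> x) = \<psi> \<phi> + \<psi> \<eta>"
  using assms by (simp add: PR_dual_def)

lemma PR_dual_cmult:
  assumes "\<psi> \<in> PR_dual" "\<phi> \<in> PR"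
  shows "\<psi> (\<lambda>x. c * \<phi> x) = c * \<psi> \<phi>"
  using assms by (simp add: PR_dual_def)

lemma PR_dual_zero:
  assumes "\<psi> \<in> PR_dual"
  shows "\<psi> (\<lambda>x. 0) = 0"
  using PR_dual_cmult[OF assms PR_const, of 0 0] by simp

lemma PR_dual_diff:
  assumes "\<psi> \<in> PR_dual" "\<phi> \<in> PR" "\<eta> \<in> PR"
  shows "\<psi> (\<lambda>x. \<phi> x - \<eta> x) = \<psi> \<phi> - \<psi> \<eta>"
  using PR_dual_add[OF assms(1,2) PR_cmult[OF assms(3), of "-1"]]
    PR_dual_cmult[OF assms(1,3), of "-1"] by simp

lemma PR_dual_sum:
  assumes "\<psi> \<in> PR_dual" and "\<And>i. i \<in> I \<Longrightarrow> \<phi> i \<in> PR"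
  shows "\<psi> (\<lambda>x. \<Sum>i\<in>I. \<phi> i x) = (\<Sum>i\<in>I. \<psi> (\<phi> i))"
  using assms(2)
proof (induction I rule: infinite_finite_induct)
  case (insert i I)
  then show ?case
    using PR_dual_add[OF assms(1), of "\<phi> i" "\<lambda>x. \<Sum>i\<in>I. \<phi> i x"] by (simp add: PR_sum)
qed (auto simp: PR_dual_zero[OF assms(1)])

lemma PR_dual_tendsto:
  assumes "\<psi> \<in> PR_dual" and "limitin PR_topology g \<phi> F"
  shows "((\<lambda>i. \<psi> (g i)) \<longlongrightarrow> \<psi> \<phi>) F"
proof -
  have "continuous_map PR_topology euclidean \<psi>"
    using assms(1) by (simp add: PR_dual_def)
  from continuous_map_limit[OF this assms(2)] show ?thesis by (simp add: o_def)
qed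

definition taylor_remainder :: "(real \<Rightarrow> complex) \<Rightarrow> real \<Rightarrow> nat \<Rightarrow> real \<Rightarrow> complex" where
  "taylor_remainder f b N =
     (\<lambda>x. f (x + b) - (\<Sum>\<alpha>\<le>N. Dn \<alpha> f b / fact \<alpha> * of_real (x ^ \<alpha>)))"

lemma PR_translate: "f \<in> PR \<Longrightarrow> (\<lambda>x. f (x + b)) \<in> PR"
  using PR_affine[of f 1 b] by simp

lemma PR_taylor_polynomial: "(\<lambda>x. \<Sum>\<alpha>\<le>N. c \<alpha> * of_real (x ^ \<alpha>)) \<in> PR"
  by (intro PR_sum PR_cmult PR_monomial)

lemma taylor_remainder_PR:
  assumes "f \<in> PR"
  shows "taylor_remainder f b N \<in> PR"
  unfolding taylor_remainder_def
  by (intro PR_diff PR_translate PR_taylor_polynomial assms)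

lemma taylor_remainder_flat:
  assumes "f \<in> PR" and "k \<le> N"
  shows "Dn k (taylor_remainder f b N) 0 = 0"
proof -
  have "Dn k (\<lambda>x. \<Sum>\<alpha>\<le>N. Dn \<alpha> f b / fact \<alpha> * of_real (x ^ \<alpha>)) 0
      = (\<Sum>\<alpha>\<le>N. Dn \<alpha> f b / fact \<alpha> * (if k = \<alpha> then fact \<alpha> else 0))"
    by (subst Dn_sum)
      (simp_all only: PR_cmult PR_monomial Dn_cmult PR_smooth Dn_monomial_0)
  also have "\<dots> = (\<Sum>\<alpha>\<le>N. if k = \<alpha> then Dn \<alpha> f b else 0)"
    by (intro sum.cong) auto
  also have "\<dots> = Dn k f b"
    using assms(2) by simp
  finally have 1: "Dn k (\<lambda>x. \<Sum>\<alpha>\<le>N. Dn \<alpha> f b / fact \<alpha> * of_real (x ^ \<alpha>)) 0 = Dn k f b" .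
  have 2: "Dn k (\<lambda>x. f (x + b)) 0 = Dn k f b"
    using Dn_affine[OF PR_smooth[OF assms(1)], of k 1 b] by simp
  show ?thesis
    unfolding taylor_remainder_def
      Dn_diff[OF PR_smooth[OF PR_translate[OF assms(1)]] PR_smooth[OF PR_taylor_polynomial]] 1 2
    by simp
qed

text \<open>The moments enter here: \<open>\<psi>\<close> is applied term by term to the dilated Taylor polynomial.\<close>

lemma PR_dual_taylor_remainder:
  assumes \<psi>: "\<psi> \<in> PR_dual" and f: "f \<in> PR"
  shows "\<psi> (\<lambda>x. taylor_remainder f b N (a * x)) =
    \<psi> (\<lambda>x. f (a * x + b)) - (\<Sum>\<alpha>\<le>N. moment \<psi> \<alpha> * Dn \<alpha> f b * of_real (a ^ \<alpha>) / fact \<alpha>)"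
proof -
  let ?c = "\<lambda>\<alpha>. Dn \<alpha> f b / fact \<alpha> * of_real (a ^ \<alpha>)"
  have "(\<lambda>x. taylor_remainder f b N (a * x))
      = (\<lambda>x. f (a * x + b) - (\<Sum>\<alpha>\<le>N. ?c \<alpha> * of_real (x ^ \<alpha>)))"
    by (simp add: taylor_remainder_def power_mult_distrib mult.assoc)
  then have "\<psi> (\<lambda>x. taylor_remainder f b N (a * x))
      = \<psi> (\<lambda>x. f (a * x + b)) - \<psi> (\<lambda>x. \<Sum>\<alpha>\<le>N. ?c \<alpha> * of_real (x ^ \<alpha>))"
    by (simp only: PR_dual_diff[OF \<psi> PR_affine[OF f] PR_taylor_polynomial])
  also have "\<psi> (\<lambda>x. \<Sum>\<alpha>\<le>N. ?c \<alpha> * of_real (x ^ \<alpha>)) = (\<Sum>\<alpha>\<le>N. ?c \<alpha> * moment \<psi> \<alpha>)"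
    by (simp only: PR_dual_sum[OF \<psi> PR_cmult[OF PR_monomial]]
        PR_dual_cmult[OF \<psi> PR_monomial] moment_def)
  finally show ?thesis
    by (simp add: mult_ac)
qed

theorem theorem3p3:
  fixes \<psi> :: "(real \<Rightarrow> complex) \<Rightarrow> complex" and f :: "real \<Rightarrow> complex" and b :: real
  assumes "\<psi> \<in> PR_dual" and "f \<in> PR"
  shows "\<forall>N::nat.
    (\<lambda>a::real. of_real (1 / sqrt a) * dilate a \<psi> (\<lambda>x. f (x + b))
        - (\<Sum>\<alpha>\<le>N. moment \<psi> \<alpha> * Dn \<alpha> f b * of_real (a powr (real \<alpha> + 1 / 2)) / fact \<alpha>))
      \<in> o[at_right 0](\<lambda>a. complex_of_real (a powr (real N + 1 / 2)))"
proof
  fix N :: nat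
  let ?r = "taylor_remainder f b N"
  let ?g = "\<lambda>a x. of_real (1 / a ^ N) * ?r (a * x)"
  let ?d = "\<lambda>a::real. of_real (1 / sqrt a) * dilate a \<psi> (\<lambda>x. f (x + b))
        - (\<Sum>\<alpha>\<le>N. moment \<psi> \<alpha> * Dn \<alpha> f b * of_real (a powr (real \<alpha> + 1 / 2)) / fact \<alpha>)"
  let ?w = "\<lambda>a. complex_of_real (a powr (real N + 1 / 2))"
  have r: "?r \<in> PR" by (rule taylor_remainder_PR[OF assms(2)])
  \<comment> \<open>The prefactor \<open>1 / sqrt a\<close> and the \<open>a\<close> from the dilation combine to \<open>sqrt a\<close>, the half power
    common to all terms of the scale.\<close>
  have quot: "\<psi> (?g a) = ?d a / ?w a" if a: "a > 0" for a
  proof -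
    have pw: "a powr (real \<alpha> + 1 / 2) = sqrt a * a ^ \<alpha>" for \<alpha>
      using a by (simp add: powr_add powr_realpow powr_half_sqrt)
    have "1 / sqrt a * a = sqrt a"
      using a real_sqrt_mult_self[of a] by (simp add: field_simps)
    then have "of_real (1 / sqrt a) * dilate a \<psi> (\<lambda>x. f (x + b))
        = of_real (sqrt a) * \<psi> (\<lambda>x. f (a * x + b))"
      unfolding dilate_def mult.assoc[symmetric] of_real_mult[symmetric] by simp
    then have "?d a = of_real (sqrt a) * \<psi> (\<lambda>x. ?r (a * x))"
      unfolding PR_dual_taylor_remainder[OF assms] pw
      by (simp add: right_diff_distrib sum_distrib_left mult_ac)
    moreover have "\<psi> (?g a) = of_real (1 / a ^ N) * \<psi> (\<lambda>x. ?r (a * x))"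
      using PR_affine[OF r, of a 0] by (intro PR_dual_cmult assms) simp
    ultimately show ?thesis
      using a by (simp add: pw)
  qed
  have pos: "\<forall>\<^sub>F a in at_right (0::real). a > 0"
    by (rule eventually_at_right_less)
  have "((\<lambda>a. \<psi> (?g a)) \<longlongrightarrow> 0) (at_right 0)"
    using PR_dual_tendsto[OF assms(1) flat_dilation_limit[OF r taylor_remainder_flat[OF assms(2)]]]
    by (simp add: PR_dual_zero[OF assms(1)])
  moreover from pos have "\<forall>\<^sub>F a in at_right 0. \<psi> (?g a) = ?d a / ?w a"
    by eventually_elim (rule quot)
  ultimately have "((\<lambda>a. ?d a / ?w a) \<longlongrightarrow> 0) (at_right 0)"
    by (rule Lim_transform_eventually)
  then show "?d \<in> o[at_right 0](?w)"
    by (rule smalloI_tendsto) (use pos in \<open>eventually_elim, simp\<close>)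
qed

end
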